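(* Let $\boldsymbol\lambda=(\lambda_c,\lambda_d)^\top\in\mathbb{R}^2_+$. Suppose that $E_c^{\min}=E_d^{\min}=0$. If $\lambda_c+\eta_c\eta_d\lambda_d\ge 1-\eta_c\eta_d$, then $z^{\mathrm{reg}}(\boldsymbol\lambda)=z^{\mathrm{reg}}_l(\boldsymbol\lambda)$.
   Context: Data. $\mathcal N$ is a finite set of buses, $\mathcal L\subseteq\mathcal N\times\mathcal N$ a finite set of transmission lines, $\mathcal N_b\subseteq\mathcal N$ the set of buses carrying a battery, $\mathcal T=\{1,\dots,T\}$ the time periods, $N=|\mathcal N|$, $N_b=|\mathcal N_b|$. For $i\in\mathcal N$, $\delta_i^+=\{j:(i,j)\in\mathcal L\}$ and $\delta_i^-=\{j:(j,i)\in\mathcal L\}$. Real parameters: $0\le G_i^{\min}\le G_i^{\max}$ ($i\in\mathcal N$), $F_{ij}\ge0$ and $B_{ij}$ ($(i,j)\in\mathcal L$), demands $D_{t,i}$, $0\le E^{\min}\le E^{\max}$, $0\le E_c^{\min}\le E_c^{\max}$, $0\le E_d^{\min}\le E_d^{\max}$, initial state-of-charge $E_0$, and efficiencies $\eta_c,\eta_d\in(0,1]$. Variables (indexed by $t\in\mathcal T$): phase angles $\theta_{t,i}$, flows $f_{t,ij}$, $\mathbf p=(\mathbf p^g,\mathbf p^s,\mathbf p^c,\mathbf p^d,\mathbf p^{ls},\mathbf p^{ex})$ (generation, state-of-charge, charging, discharging, load shedding, excess power; $p^s$ also has components $p^s_{0,i}$), and $u_{t,i}$. Operational constraints: - $G_i^{\min}\le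 p^g_{t,i}\le G_i^{\max}$ for all $t\in\mathcal T,i\in\mathcal N$; - $-F_{ij}\le f_{t,ij}\le F_{ij}$ and $f_{t,ij}=B_{ij}(\theta_{t,i}-\theta_{t,j})$ for all $t\in\mathcal T,(i,j)\in\mathcal L$; - for $t\in\mathcal T,i\in\mathcal N_b$: $E_c^{\min}u_{t,i}\le p^c_{t,i}\le E_c^{\max}u_{t,i}$; $E_d^{\min}(1-u_{t,i})\le p^d_{t,i}\le E_d^{\max}(1-u_{t,i})$; $p^s_{t,i}=p^s_{t-1,i}+\eta_c p^c_{t,i}-\frac1{\eta_d}p^d_{t,i}$; $p^s_{0,i}=E_0$; $E^{\min}\le p^s_{t,i}\le E^{\max}$; - for $t\in\mathcal T,i\in\mathcal N\setminus\mathcal N_b$: $p^s_{t,i}=p^s_{0,i}=p^c_{t,i}=p^d_{t,i}=u_{t,i}=0$; - $p^{ls}_{t,i}\ge0$, $p^{ex}_{t,i}\ge0$ for all $t\in\mathcal T,i\in\mathcal N$; - $\sum_{j\in\delta_i^+}f_{t,ij}-\sum_{j\in\delta_i^-}f_{t,ji}=p^g_{t,i}-D_{t,i}-p^c_{t,i}+p^d_{t,i}+p^{ls}_{t,i}-p^{ex}_{t,i}$ for all $t\in\mathcal T,i\in\mathcal N$. Objective: $c(\mathbf p)=c^g(\mathbf p^g)+\sum_{t\in\mathcal T}\sum_{i\in\mathcal N}(p^{ls}_{t,i}+p^{ex}_{t,i})$, where $c^g$ is a real-valued generator cost function (usually linear or convex quadratic), and $g(\mathbf p)=\left(\sum_{t\in\mathcal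 T}\sum_{i\in\mathcal N}p^c_{t,i},\ \sum_{t\in\mathcal T}\sum_{i\in\mathcal N}p^d_{t,i}\right)^\top$. For $\boldsymbol\lambda\in\mathbb R_+^2$, $z^{\mathrm{reg}}(\boldsymbol\lambda)$ is the minimum of $c(\mathbf p)+\boldsymbol\lambda^\top g(\mathbf p)$ over all $(\boldsymbol\theta,\mathbf f,\mathbf p,\mathbf u)$ satisfying the operational constraints and $\mathbf u\in\{0,1\}^{T\times N}$; $z^{\mathrm{reg}}_l(\boldsymbol\lambda)$ is the minimum of the same objective under the operational constraints with $\mathbf u\in[0,1]^{T\times N}$ instead. (Optimal values are infima, equal to $+\infty$ if infeasible.) *)

theory Defs
  imports "HOL-Analysis.Analysis"
begin

record 'b network =
  buses :: "'b set"
  lines :: "('b \<times> 'b) set"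
  battery_buses :: "'b set"
  horizon :: nat
  Gmin :: "'b \<Rightarrow> real"
  Gmax :: "'b \<Rightarrow> real"
  Fcap :: "'b \<Rightarrow> 'b \<Rightarrow> real"
  suscep :: "'b \<Rightarrow> 'b \<Rightarrow> real"
  demand :: "nat \<Rightarrow> 'b \<Rightarrow> real"
  Emin :: real
  Emax :: real
  Ec_min :: real
  Ec_max :: real
  Ed_min :: real
  Ed_max :: real
  E_init :: real
  eta_c :: real
  eta_d :: real
  gen_cost :: "(nat \<times> 'b \<Rightarrow> real) \<Rightarrow> real"

text \<open>Power variables: generation, state of charge, charging, discharging, load shedding,
  excess power. The state of charge also has a component at time \<open>0\<close>.\<close>

record 'b power =
  pg :: "nat \<Rightarrow> 'b \<Rightarrow> real"
  ps :: "nat \<Rightarrow> 'b \<Rightarrow> real"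
  pc :: "nat \<Rightarrow> 'b \<Rightarrow> real"
  pd :: "nat \<Rightarrow> 'b \<Rightarrow> real"
  pls :: "nat \<Rightarrow> 'b \<Rightarrow> real"
  pex :: "nat \<Rightarrow> 'b \<Rightarrow> real"

definition periods :: "'b network \<Rightarrow> nat set" where
  "periods P = {1..horizon P}"

definition delta_plus :: "'b network \<Rightarrow> 'b \<Rightarrow> 'b set" where
  "delta_plus P i = {j. (i, j) \<in> lines P}"

definition delta_minus :: "'b network \<Rightarrow> 'b \<Rightarrow> 'b set" where
  "delta_minus P i = {j. (j, i) \<in> lines P}"

definition valid_network :: "'b network \<Rightarrow> bool" where
  "valid_network P \<longleftrightarrow>
     finite (buses P) \<and>
     lines P \<subseteq> buses P \<times> buses P \<and>
     battery_buses P \<subseteq> buses P \<and>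
     (\<forall>i\<in>buses P. 0 \<le> Gmin P i \<and> Gmin P i \<le> Gmax P i) \<and>
     (\<forall>(i, j)\<in>lines P. 0 \<le> Fcap P i j) \<and>
     0 \<le> Emin P \<and> Emin P \<le> Emax P \<and>
     0 \<le> Ec_min P \<and> Ec_min P \<le> Ec_max P \<and>
     0 \<le> Ed_min P \<and> Ed_min P \<le> Ed_max P \<and>
     0 < eta_c P \<and> eta_c P \<le> 1 \<and>
     0 < eta_d P \<and> eta_d P \<le> 1"

definition operational ::
  "'b network \<Rightarrow> (nat \<Rightarrow> 'b \<Rightarrow> real) \<Rightarrow> (nat \<Rightarrow> 'b \<Rightarrow> 'b \<Rightarrow> real) \<Rightarrow> 'b power
    \<Rightarrow> (nat \<Rightarrow> 'b \<Rightarrow> real) \<Rightarrow> bool" where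
  "operational P \<theta> f p u \<longleftrightarrow>
     (\<forall>t\<in>periods P. \<forall>i\<in>buses P. Gmin P i \<le> pg p t i \<and> pg p t i \<le> Gmax P i) \<and>
     (\<forall>t\<in>periods P. \<forall>(i, j)\<in>lines P.
        - Fcap P i j \<le> f t i j \<and> f t i j \<le> Fcap P i j \<and>
        f t i j = suscep P i j * (\<theta> t i - \<theta> t j)) \<and>
     (\<forall>t\<in>periods P. \<forall>i\<in>battery_buses P.
        Ec_min P * u t i \<le> pc p t i \<and> pc p t i \<le> Ec_max P * u t i \<and>
        Ed_min P * (1 - u t i) \<le> pd p t i \<and> pd p t i \<le> Ed_max P * (1 - u t i) \<and>
        ps p t i = ps p (t - 1) i + eta_c P * pc p t i - 1 / eta_d P * pd p t i \<and>
        ps p 0 i = E_init P \<and>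
        Emin P \<le> ps p t i \<and> ps p t i \<le> Emax P) \<and>
     (\<forall>t\<in>periods P. \<forall>i\<in>buses P - battery_buses P.
        ps p t i = 0 \<and> ps p 0 i = 0 \<and> pc p t i = 0 \<and> pd p t i = 0 \<and> u t i = 0) \<and>
     (\<forall>t\<in>periods P. \<forall>i\<in>buses P. 0 \<le> pls p t i \<and> 0 \<le> pex p t i) \<and>
     (\<forall>t\<in>periods P. \<forall>i\<in>buses P.
        (\<Sum>j\<in>delta_plus P i. f t i j) - (\<Sum>j\<in>delta_minus P i. f t j i)
          = pg p t i - demand P t i - pc p t i + pd p t i + pls p t i - pex p t i)"

text \<open>Variables are total functions whose values outside the index sets are unconstrained.
  The restriction ensures that the generator cost only sees the actual components of \<open>pg\<close>.\<close>

definition cost :: "'b network \<Rightarrow> 'b power \<Rightarrow> real" where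
  "cost P p =
     gen_cost P (\<lambda>(t, i)\<in>periods P \<times> buses P. pg p t i)
     + (\<Sum>t\<in>periods P. \<Sum>i\<in>buses P. pls p t i + pex p t i)"

definition throughput :: "'b network \<Rightarrow> 'b power \<Rightarrow> real \<times> real" where
  "throughput P p =
     (\<Sum>t\<in>periods P. \<Sum>i\<in>buses P. pc p t i, \<Sum>t\<in>periods P. \<Sum>i\<in>buses P. pd p t i)"

text \<open>Optimal values are infima in the extended reals, so an infeasible problem has
  value \<open>\<infinity>\<close>. The set \<open>U\<close> contains the admissible values of each \<open>u t i\<close>.\<close>

definition opt_value :: "real set \<Rightarrow> 'b network \<Rightarrow> real \<times> real \<Rightarrow> ereal" where
  "opt_value U P lam =
     (INF (\<theta>, f, p, u) \<in> {(\<theta>, f, p, u). operational P \<theta> f p u \<and>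
          (\<forall>t\<in>periods P. \<forall>i\<in>buses P. u t i \<in> U)}.
        ereal (cost P p + lam \<bullet> throughput P p))"

definition z_reg :: "'b network \<Rightarrow> real \<times> real \<Rightarrow> ereal" where
  "z_reg = opt_value {0, 1}"

definition z_reg_l :: "'b network \<Rightarrow> real \<times> real \<Rightarrow> ereal" where
  "z_reg_l = opt_value {0..1}"

end

theory Submission
  imports Defs
begin

text \<open>In a feasible point of the relaxation, simultaneous charging and discharging can be netted
  out: lowering \<open>p\<^sup>c\<close> by \<open>a\<close> and \<open>p\<^sup>d\<close> by \<open>\<eta>\<^sub>c \<eta>\<^sub>d a\<close> leaves the state of charge unchanged and
  frees the power \<open>(1 - \<eta>\<^sub>c \<eta>\<^sub>d) a\<close>, which is added to \<open>p\<^sup>e\<^sup>x\<close>. The objective changes by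
  \<open>(1 - \<eta>\<^sub>c \<eta>\<^sub>d) a - \<lambda>\<^sub>c a - \<lambda>\<^sub>d \<eta>\<^sub>c \<eta>\<^sub>d a \<le> 0\<close>. For the largest admissible \<open>a\<close>, charging or discharging
  vanishes, so \<open>u\<close> can be chosen binary.\<close>

text \<open>The largest \<open>a\<close> that keeps both reduced quantities nonnegative; the divisor
  is the round-trip efficiency.\<close>

definition netted :: "'b network \<Rightarrow> 'b power \<Rightarrow> nat \<Rightarrow> 'b \<Rightarrow> real" where
  "netted P p t i = min (pc p t i) (pd p t i / (eta_c P * eta_d P))"

definition net_power :: "'b network \<Rightarrow> 'b power \<Rightarrow> 'b power" where
  "net_power P p = p\<lparr>
     pc := (\<lambda>t i. pc p t i - netted P p t i),
     pd := (\<lambda>t i. pd p t i - eta_c P * eta_d P * netted P p t i),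
     pex := (\<lambda>t i. pex p t i + (1 - eta_c P * eta_d P) * netted P p t i)\<rparr>"

text \<open>An idle battery counts as charging, which is admissible once the minimal charging rate
  is zero. The membership test is there because \<open>u\<close> must vanish at buses without a
  battery.\<close>

definition net_mode :: "'b network \<Rightarrow> 'b power \<Rightarrow> nat \<Rightarrow> 'b \<Rightarrow> real" where
  "net_mode P p t i = (if i \<in> battery_buses P \<and> pd (net_power P p) t i = 0 then 1 else 0)"

lemma eta_prod:
  assumes "valid_network P"
  shows "0 < eta_c P * eta_d P" "eta_c P * eta_d P \<le> 1"
  using assms by (auto simp: valid_network_def intro: mult_le_one)

lemma charge_discharge_nonneg:
  assumes "operational P \<theta> f p u" "Ec_min P = 0" "Ed_min P = 0"
    and "t \<in> periods P" "i \<in> buses P"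
  shows "0 \<le> pc p t i" "0 \<le> pd p t i"
  using assms unfolding operational_def by (cases "i \<in> battery_buses P"; fastforce)+

lemma netted_nonneg:
  assumes "valid_network P" "operational P \<theta> f p u" "Ec_min P = 0" "Ed_min P = 0"
    and "t \<in> periods P" "i \<in> buses P"
  shows "0 \<le> netted P p t i"
  using charge_discharge_nonneg[OF assms(2-)] eta_prod[OF assms(1)]
  by (simp add: netted_def)

text \<open>The last claim holds because the minimum in \<open>netted\<close> is attained: at its
  first argument charging becomes zero, at its second discharging does.\<close>

lemma net_power_bounds:
  assumes "valid_network P" "operational P \<theta> f p u" "Ec_min P = 0" "Ed_min P = 0"
    and "t \<in> periods P" "i \<in> buses P"
  shows "0 \<le> pc (net_power P p) t i" "pc (net_power P p) t i \<le> pc p t i"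
    and "0 \<le> pd (net_power P p) t i" "pd (net_power P p) t i \<le> pd p t i"
    and "pc (net_power P p) t i = 0 \<or> pd (net_power P p) t i = 0"
proof -
  note pos = eta_prod(1)[OF assms(1)]
  note nonneg = netted_nonneg[OF assms]
  show "0 \<le> pc (net_power P p) t i" "pc (net_power P p) t i \<le> pc p t i"
    using nonneg by (auto simp: net_power_def netted_def)
  have "netted P p t i \<le> pd p t i / (eta_c P * eta_d P)"
    by (simp add: netted_def)
  then show "0 \<le> pd (net_power P p) t i"
    using pos by (simp add: net_power_def pos_le_divide_eq mult.commute)
  show "pd (net_power P p) t i \<le> pd p t i"
    using nonneg pos by (simp add: net_power_def)
  show "pc (net_power P p) t i = 0 \<or> pd (net_power P p) t i = 0"
    using pos by (auto simp: net_power_def netted_def min_def)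
qed

lemma operational_net_power:
  assumes val: "valid_network P" and op: "operational P \<theta> f p u"
    and min0: "Ec_min P = 0" "Ed_min P = 0"
    and u01: "\<forall>t\<in>periods P. \<forall>i\<in>buses P. u t i \<in> {0..1}"
  shows "operational P \<theta> f (net_power P p) (net_mode P p)"
proof -
  have sub: "battery_buses P \<subseteq> buses P" and max0: "0 \<le> Ec_max P" "0 \<le> Ed_max P"
    and eta: "0 < eta_d P"
    using val by (auto simp: valid_network_def)
  have battery: "Ec_min P * net_mode P p t i \<le> pc (net_power P p) t i \<and>
      pc (net_power P p) t i \<le> Ec_max P * net_mode P p t i \<and>
      Ed_min P * (1 - net_mode P p t i) \<le> pd (net_power P p) t i \<and>
      pd (net_power P p) t i \<le> Ed_max P * (1 - net_mode P p t i) \<and>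
      eta_c P * pc (net_power P p) t i - 1 / eta_d P * pd (net_power P p) t i
        = eta_c P * pc p t i - 1 / eta_d P * pd p t i"
    if ti: "t \<in> periods P" "i \<in> battery_buses P" for t i
  proof -
    have i: "i \<in> buses P" using ti sub by auto
    note bounds = net_power_bounds[OF val op min0 ti(1) i]
    have "pc p t i \<le> Ec_max P * u t i" "pd p t i \<le> Ed_max P * (1 - u t i)"
      using op ti unfolding operational_def by blast+
    \<comment> \<open>A fractional \<open>u\<close> only shrinks the two capacities, so the relaxed
      limits imply the full ones that a binary mode grants.\<close>
    moreover have "Ec_max P * u t i \<le> Ec_max P" "Ed_max P * (1 - u t i) \<le> Ed_max P"
      using u01 ti i max0 by (auto intro!: mult_left_le)
    ultimately have "pc (net_power P p) t i \<le> Ec_max P" "pd (net_power P p) t i \<le> Ed_max P"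
      using bounds by linarith+
    moreover have "eta_c P * pc (net_power P p) t i - 1 / eta_d P * pd (net_power P p) t i
        = eta_c P * pc p t i - 1 / eta_d P * pd p t i"
      using eta by (simp add: net_power_def field_simps)
    \<comment> \<open>In mode 1 discharging is zero by definition of the mode; in mode 0 it is
      nonzero, so charging is zero.\<close>
    ultimately show ?thesis
      using bounds min0 ti by (auto simp: net_mode_def)
  qed
  have idle: "pc (net_power P p) t i = 0 \<and> pd (net_power P p) t i = 0 \<and> net_mode P p t i = 0"
    if "t \<in> periods P" "i \<in> buses P - battery_buses P" for t i
    using op that by (simp add: operational_def net_power_def netted_def net_mode_def)
  have excess: "0 \<le> pex (net_power P p) t i" if "t \<in> periods P" "i \<in> buses P" for t i
    using op that netted_nonneg[OF val op min0 that] eta_prod[OF val]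
    by (simp add: operational_def net_power_def)
  \<comment> \<open>With \<open>a\<close> the netted amount and \<open>r\<close> the round-trip
    efficiency, the changes are \<open>a - r * a - (1 - r) * a = 0\<close>, so the flows and phase
    angles can stay as they are.\<close>
  have balance: "- pc (net_power P p) t i + pd (net_power P p) t i - pex (net_power P p) t i
      = - pc p t i + pd p t i - pex p t i" for t i
    by (simp add: net_power_def algebra_simps)
  have [simp]: "pg (net_power P p) = pg p" "ps (net_power P p) = ps p"
    "pls (net_power P p) = pls p"
    by (simp_all add: net_power_def)
  show ?thesis
    unfolding operational_def
  proof (intro conjI)
    show "\<forall>t\<in>periods P. \<forall>i\<in>battery_buses P.
        Ec_min P * net_mode P p t i \<le> pc (net_power P p) t i \<and>
        pc (net_power P p) t i \<le> Ec_max P * net_mode P p t i \<and>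
        Ed_min P * (1 - net_mode P p t i) \<le> pd (net_power P p) t i \<and>
        pd (net_power P p) t i \<le> Ed_max P * (1 - net_mode P p t i) \<and>
        ps (net_power P p) t i = ps (net_power P p) (t - 1) i
          + eta_c P * pc (net_power P p) t i - 1 / eta_d P * pd (net_power P p) t i \<and>
        ps (net_power P p) 0 i = E_init P \<and>
        Emin P \<le> ps (net_power P p) t i \<and> ps (net_power P p) t i \<le> Emax P"
    proof (intro ballI)
      fix t i assume ti: "t \<in> periods P" "i \<in> battery_buses P"
      have "ps p t i = ps p (t - 1) i + eta_c P * pc p t i - 1 / eta_d P * pd p t i"
        "ps p 0 i = E_init P" "Emin P \<le> ps p t i" "ps p t i \<le> Emax P"
        using op ti unfolding operational_def by blast+
      then show "Ec_min P * net_mode P p t i \<le> pc (net_power P p) t i \<and>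
          pc (net_power P p) t i \<le> Ec_max P * net_mode P p t i \<and>
          Ed_min P * (1 - net_mode P p t i) \<le> pd (net_power P p) t i \<and>
          pd (net_power P p) t i \<le> Ed_max P * (1 - net_mode P p t i) \<and>
          ps (net_power P p) t i = ps (net_power P p) (t - 1) i
            + eta_c P * pc (net_power P p) t i - 1 / eta_d P * pd (net_power P p) t i \<and>
          ps (net_power P p) 0 i = E_init P \<and>
          Emin P \<le> ps (net_power P p) t i \<and> ps (net_power P p) t i \<le> Emax P"
        using battery[OF ti] by simp
    qed
    show "\<forall>t\<in>periods P. \<forall>i\<in>buses P.
        (\<Sum>j\<in>delta_plus P i. f t i j) - (\<Sum>j\<in>delta_minus P i. f t j i)
          = pg (net_power P p) t i - demand P t i - pc (net_power P p) t i
            + pd (net_power P p) t i + pls (net_power P p) t i - pex (net_power P p) t i"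
    proof (intro ballI)
      fix t i assume "t \<in> periods P" "i \<in> buses P"
      then have "(\<Sum>j\<in>delta_plus P i. f t i j) - (\<Sum>j\<in>delta_minus P i. f t j i)
          = pg p t i - demand P t i - pc p t i + pd p t i + pls p t i - pex p t i"
        using op unfolding operational_def by blast
      then show "(\<Sum>j\<in>delta_plus P i. f t i j) - (\<Sum>j\<in>delta_minus P i. f t j i)
          = pg (net_power P p) t i - demand P t i - pc (net_power P p) t i
            + pd (net_power P p) t i + pls (net_power P p) t i - pex (net_power P p) t i"
        using balance[of t i] by simp
    qed
  qed (use op idle excess in \<open>simp_all add: operational_def\<close>)
qed

lemma objective_net_power_le:
  assumes val: "valid_network P" and op: "operational P \<theta> f p u"
    and min0: "Ec_min P = 0" "Ed_min P = 0"
    and lam: "lam_c + eta_c P * eta_d P * lam_d \<ge> 1 - eta_c P * eta_d P"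
  shows "cost P (net_power P p) + (lam_c, lam_d) \<bullet> throughput P (net_power P p)
    \<le> cost P p + (lam_c, lam_d) \<bullet> throughput P p"
proof -
  \<comment> \<open>Everything except the generator cost is gathered into one double sum, so that
    the comparison can be made term by term; netting leaves \<open>pg\<close> unchanged.\<close>
  have objective: "cost P q + (lam_c, lam_d) \<bullet> throughput P q
      = gen_cost P (\<lambda>(t, i)\<in>periods P \<times> buses P. pg q t i)
        + (\<Sum>t\<in>periods P. \<Sum>i\<in>buses P.
            pls q t i + pex q t i + lam_c * pc q t i + lam_d * pd q t i)" for q
    by (simp add: cost_def throughput_def sum.distrib sum_distrib_left)
  have "pls (net_power P p) t i + pex (net_power P p) t i
        + lam_c * pc (net_power P p) t i + lam_d * pd (net_power P p) t i
      \<le> pls p t i + pex p t i + lam_c * pc p t i + lam_d * pd p t i"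
    if "t \<in> periods P" "i \<in> buses P" for t i
  proof -
    have "(1 - eta_c P * eta_d P) * netted P p t i
        \<le> (lam_c + eta_c P * eta_d P * lam_d) * netted P p t i"
      using lam netted_nonneg[OF val op min0 that] by (rule mult_right_mono)
    then show ?thesis
      by (simp add: net_power_def algebra_simps)
  qed
  then show ?thesis
    unfolding objective by (simp add: net_power_def sum_mono)
qed

lemma opt_value_antimono:
  assumes "U \<subseteq> V"
  shows "opt_value V P lam \<le> opt_value U P lam"
  unfolding opt_value_def using assms by (intro INF_superset_mono) auto

theorem theorem1:
  fixes P :: "'b network" and lam_c lam_d :: real
  assumes "valid_network P"
    and "0 \<le> lam_c" and "0 \<le> lam_d"
    and "Ec_min P = 0" and "Ed_min P = 0"
    and "lam_c + eta_c P * eta_d P * lam_d \<ge> 1 - eta_c P * eta_d P"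
  shows "z_reg P (lam_c, lam_d) = z_reg_l P (lam_c, lam_d)"
proof (rule antisym)
  show "z_reg_l P (lam_c, lam_d) \<le> z_reg P (lam_c, lam_d)"
    unfolding z_reg_def z_reg_l_def by (rule opt_value_antimono) auto
  show "z_reg P (lam_c, lam_d) \<le> z_reg_l P (lam_c, lam_d)"
    unfolding z_reg_def z_reg_l_def opt_value_def
  \<comment> \<open>It is enough to match each feasible point of the relaxation with a binary one of
    no larger objective. No minimizer has to exist, and an infeasible relaxation is covered
    vacuously.\<close>
  proof (rule INF_mono, clarify)
    fix \<theta> f p u
    assume op: "operational P \<theta> f p u"
      and u: "\<forall>t\<in>periods P. \<forall>i\<in>buses P. u t i \<in> {0..1}"
    show "\<exists>x\<in>{(\<theta>, f, p, u). operational P \<theta> f p u \<and>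
          (\<forall>t\<in>periods P. \<forall>i\<in>buses P. u t i \<in> {0, 1})}.
        (case x of (\<theta>, f, p, u) \<Rightarrow> ereal (cost P p + (lam_c, lam_d) \<bullet> throughput P p))
          \<le> ereal (cost P p + (lam_c, lam_d) \<bullet> throughput P p)"
      using operational_net_power[OF assms(1) op assms(4,5) u]
        objective_net_power_le[OF assms(1) op assms(4-6)]
      by (intro bexI[of _ "(\<theta>, f, net_power P p, net_mode P p)"]) (auto simp: net_mode_def)
  qed
qed

end
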